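(* Let $S$ be an Arf numerical semigroup whose multiplicity is at most five or whose conductor is a multiple of its multiplicity, and let $\Bbbk$ be an algebraically closed field of characteristic zero. Then there is a row-factorization matrix of the Frobenius number $F(S)$ such that, with $W(S)$ the $\mathbb{Z}$-module associated with this matrix, the defining ideal $I_S$ of $\Bbbk[S]$ is generated by the set $\{\mathbf{x}^{\mathbf{v}^+}-\mathbf{x}^{\mathbf{v}^-}\mid \mathbf{v}\in W(S)\}$.
   Context: $\mathbb{N}_0$ denotes the non-negative integers. A numerical semigroup is a subset $S\subseteq\mathbb{N}_0$ containing $0$, closed under addition, with finite complement in $\mathbb{N}_0$. Its multiplicity is its smallest nonzero element; its Frobenius number $F(S)$ is the greatest integer not in $S$ (so $F(\mathbb{N}_0)=-1$); its conductor is $F(S)+1$. $S$ is Arf if $s_2+s_3-s_1\in S$ for all $s_1\le s_2\le s_3$ in $S$. Let $n_1<\dots<n_e$ be the minimal generators of $S$. A row-factorization matrix (RF-matrix) of $F(S)$ is an $e\times e$ integer matrix $[a_{ij}]$ with $a_{ii}=-1$, $a_{ij}\in\mathbb{N}_0$ for $i\neq j$, and $F(S)=\sum_{j}a_{ij}n_j$ for each $i$. If $\mathbf{a}_1,\dots,\mathbf{a}_e$ are the row vectors of such a matrix, put $\mathbf{a}_{ij}=\mathbf{a}_i-\mathbf{a}_j$ for $1\le i<j\le e$ and $W(S)=\sum_{i<j}\mathbf{a}_{ij}\mathbb{Z}\subseteq\mathbb{Z}^e$. $\Bbbk[S]=\Bbbk[t^s\mid s\in S]\subseteq\Bbbk[t]$,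 and the defining ideal $I_S$ is the kernel of the surjective ring homomorphism ($\Bbbk$-algebra map) $\Bbbk[x_1,\dots,x_e]\to\Bbbk[S]$, $x_i\mapsto t^{n_i}$. For $\mathbf{a}\in\mathbb{N}_0^e$, $\mathbf{x}^{\mathbf{a}}=x_1^{a_1}\cdots x_e^{a_e}$. For $\mathbf{v}\in\mathbb{Z}^e$, $\mathbf{v}^+$ has $i$-th component $v_i$ if $v_i>0$ and $0$ otherwise, and $\mathbf{v}^-=\mathbf{v}^+-\mathbf{v}$. *)

theory Defs
  imports
    "HOL-Computational_Algebra.Polynomial"
    "HOL-Library.Poly_Mapping"
    "HOL-Algebra.Generated_Rings"
    "HOL-Algebra.QuotRing"
    "Jordan_Normal_Form.Matrix"
begin

section \<open>Numerical semigroups\<close>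

definition numerical_semigroup :: "nat set \<Rightarrow> bool" where
  "numerical_semigroup S \<longleftrightarrow>
     0 \<in> S \<and> (\<forall>a\<in>S. \<forall>b\<in>S. a + b \<in> S) \<and> finite (UNIV - S)"

definition multiplicity :: "nat set \<Rightarrow> nat" where
  "multiplicity S = (LEAST s. s \<in> S \<and> s \<noteq> 0)"

text \<open>The Frobenius number is taken in the integers, so that it is \<open>-1\<close> for \<open>S = UNIV\<close>.\<close>

definition frobenius :: "nat set \<Rightarrow> int" where
  "frobenius S = (GREATEST z. z \<notin> int ` S)"

definition conductor :: "nat set \<Rightarrow> int" where
  "conductor S = frobenius S + 1"

definition arf :: "nat set \<Rightarrow> bool" where
  "arf S \<longleftrightarrow>
     (\<forall>s1\<in>S. \<forall>s2\<in>S. \<forall>s3\<in>S. s1 \<le> s2 \<longrightarrow> s2 \<le> s3 \<longrightarrow> s2 + s3 - s1 \<in> S)"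

inductive_set submonoid_generated :: "nat set \<Rightarrow> nat set" for A :: "nat set" where
  zero: "0 \<in> submonoid_generated A"
| incl: "a \<in> A \<Longrightarrow> a \<in> submonoid_generated A"
| add: "x \<in> submonoid_generated A \<Longrightarrow> y \<in> submonoid_generated A
    \<Longrightarrow> x + y \<in> submonoid_generated A"

text \<open>The strictly increasing list \<open>ns\<close> is \<open>n\<^sub>1 < \<dots> < n\<^sub>e\<close> with \<open>e = length ns\<close>;
  as everywhere below, indices start at \<open>0\<close>.\<close>

definition minimal_generators :: "nat set \<Rightarrow> nat list \<Rightarrow> bool" where
  "minimal_generators S ns \<longleftrightarrow>
     sorted_wrt (<) ns \<and> submonoid_generated (set ns) = S \<and>
     (\<forall>B. B \<subset> set ns \<longrightarrow> submonoid_generated B \<noteq> S)"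


section \<open>Row-factorization matrices\<close>

definition rf_matrix :: "nat list \<Rightarrow> int \<Rightarrow> int mat \<Rightarrow> bool" where
  "rf_matrix ns f A \<longleftrightarrow>
     A \<in> carrier_mat (length ns) (length ns) \<and>
     (\<forall>i<length ns. A $$ (i, i) = -1) \<and>
     (\<forall>i<length ns. \<forall>j<length ns. i \<noteq> j \<longrightarrow> A $$ (i, j) \<ge> 0) \<and>
     (\<forall>i<length ns. f = (\<Sum>j<length ns. A $$ (i, j) * int (ns ! j)))"

text \<open>The integer combinations of the differences of rows \<open>i < j\<close>, written out in coordinates.\<close>

definition row_difference_module :: "int mat \<Rightarrow> int vec set" where
  "row_difference_module A =
     {vec (dim_col A) (\<lambda>k. \<Sum>(i, j)\<in>{(i, j). i < j \<and> j < dim_row A}.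
        c i j * ((row A i - row A j) $ k)) | c :: nat \<Rightarrow> nat \<Rightarrow> int. True}"

definition pos_vec :: "int vec \<Rightarrow> int vec" where
  "pos_vec v = map_vec (\<lambda>z. if z > 0 then z else 0) v"

definition neg_vec :: "int vec \<Rightarrow> int vec" where
  "neg_vec v = pos_vec v - v"


section \<open>Defining ideals of semigroup rings\<close>

text \<open>Polynomials in the variables \<open>x\<^sub>0, x\<^sub>1, \<dots>\<close> are finitely supported maps from exponents to
  coefficients, exponents being finitely supported maps from variable indices to \<open>nat\<close>.\<close>

type_synonym 'k mpoly = "(nat \<Rightarrow>\<^sub>0 nat) \<Rightarrow>\<^sub>0 'k"

definition var :: "nat \<Rightarrow> 'k::field mpoly" where
  "var i = Poly_Mapping.single (Poly_Mapping.single i 1) 1"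

definition monomial :: "nat vec \<Rightarrow> 'k::field mpoly" where
  "monomial a = (\<Prod>i<dim_vec a. var i ^ (a $ i))"

definition binomial :: "int vec \<Rightarrow> 'k::field mpoly" where
  "binomial v = monomial (map_vec nat (pos_vec v)) - monomial (map_vec nat (neg_vec v))"

definition poly_ring :: "nat \<Rightarrow> 'k::field mpoly ring" where
  "poly_ring e = \<lparr>carrier = {p. \<forall>a\<in>Poly_Mapping.keys p. Poly_Mapping.keys a \<subseteq> {..<e}},
     mult = (*), one = 1, zero = 0, add = (+)\<rparr>"

definition univariate_ring :: "'k::field poly ring" where
  "univariate_ring = \<lparr>carrier = UNIV, mult = (*), one = 1, zero = 0, add = (+)\<rparr>"

definition semigroup_ring :: "nat set \<Rightarrow> 'k::field poly ring" where
  "semigroup_ring S = univariate_ring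
     \<lparr>carrier := generate_ring univariate_ring (range (\<lambda>c. [:c:]) \<union> {Polynomial.monom 1 s | s. s \<in> S})\<rparr>"

text \<open>The algebra homomorphism with \<open>x\<^sub>i \<mapsto> t\<^bsup>n\<^sub>i\<^esup>\<close>, extended linearly and multiplicatively.\<close>

definition semigroup_map :: "nat list \<Rightarrow> 'k::field mpoly \<Rightarrow> 'k poly" where
  "semigroup_map ns p = (\<Sum>a\<in>Poly_Mapping.keys p.
     Polynomial.smult (Poly_Mapping.lookup p a)
       (\<Prod>i\<in>Poly_Mapping.keys a. Polynomial.monom 1 (ns ! i) ^ Poly_Mapping.lookup a i))"

definition defining_ideal :: "nat set \<Rightarrow> nat list \<Rightarrow> 'k::field mpoly set" where
  "defining_ideal S ns =
     a_kernel (poly_ring (length ns)) (semigroup_ring S) (semigroup_map ns)"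

section \<open>Well-definedness\<close>

text \<open>A numerical semigroup has exactly one list of minimal generators, its Frobenius number is
  attained, the rings above are commutative rings, and \<^const>\<open>semigroup_map\<close> is a surjective ring
  homomorphism fixing constants with \<open>x\<^sub>i \<mapsto> t\<^bsup>n\<^sub>i\<^esup>\<close>.\<close>

lemma submonoid_generated_closed:
  assumes "x \<in> submonoid_generated A" "0 \<in> S" "\<forall>a\<in>S. \<forall>b\<in>S. a + b \<in> S" "A \<subseteq> S"
  shows "x \<in> S"
  using assms by induction auto

lemma submonoid_generated_atom:
  assumes "x \<in> submonoid_generated A" "x \<noteq> 0"
    "\<And>a b. a \<in> submonoid_generated A \<Longrightarrow> b \<in> submonoid_generated A \<Longrightarrow> x = a + b \<Longrightarrow> a = 0 \<or> b = 0"
  shows "x \<in> A"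
  using assms
proof induction
  case (add x y)
  then have "x = 0 \<or> y = 0" by blast
  then show ?case
  proof
    assume "x = 0"
    with add show ?thesis by simp
  next
    assume "y = 0"
    with add show ?thesis by simp
  qed
qed simp_all

definition atoms :: "nat set \<Rightarrow> nat set" where
  "atoms S = {x\<in>S. x \<noteq> 0 \<and> (\<forall>a\<in>S. \<forall>b\<in>S. x = a + b \<longrightarrow> a = 0 \<or> b = 0)}"

lemma submonoid_generated_atoms:
  assumes "numerical_semigroup S"
  shows "submonoid_generated (atoms S) = S"
proof (intro equalityI subsetI)
  fix x assume "x \<in> submonoid_generated (atoms S)"
  then show "x \<in> S"
    by (rule submonoid_generated_closed) (use assms in \<open>auto simp: atoms_def numerical_semigroup_def\<close>)
next
  fix x assume "x \<in> S"
  then show "x \<in> submonoid_generated (atoms S)"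
  proof (induction x rule: less_induct)
    case (less x)
    show ?case
    proof (cases "x = 0 \<or> x \<in> atoms S")
      case True
      then show ?thesis by (auto intro: submonoid_generated.intros)
    next
      case False
      then obtain a b where "a \<in> S" "b \<in> S" "x = a + b" "a \<noteq> 0" "b \<noteq> 0"
        using less.prems by (auto simp: atoms_def)
      then show ?thesis using less.IH[of a] less.IH[of b]
        by (auto intro: submonoid_generated.add)
    qed
  qed
qed

lemma finite_atoms:
  assumes "numerical_semigroup S"
  shows "finite (atoms S)"
proof -
  have fin: "finite (UNIV - S)" and z: "0 \<in> S"
    using assms by (auto simp: numerical_semigroup_def)
  define m where "m = Suc (Max (insert 0 (UNIV - S)))"
  have big: "x \<in> S" if "x \<ge> m" for x
  proof (rule ccontr)
    assume "x \<notin> S"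
    then have "x \<le> Max (insert 0 (UNIV - S))" using fin by (intro Max_ge) auto
    then show False using that by (simp add: m_def)
  qed
  have "atoms S \<subseteq> {..<2 * m}"
  proof
    fix x assume x: "x \<in> atoms S"
    show "x \<in> {..<2 * m}"
    proof (rule ccontr)
      assume "x \<notin> {..<2 * m}"
      then have "x = m + (x - m)" "x - m \<ge> m" by auto
      moreover have "m > 0" by (simp add: m_def)
      ultimately show False using x big[of m] big[of "x - m"]
        unfolding atoms_def by (smt (verit) mem_Collect_eq order_refl not_le)
    qed
  qed
  then show ?thesis by (rule finite_subset) simp
qed

lemma minimal_generators_iff:
  assumes "numerical_semigroup S"
  shows "minimal_generators S ns \<longleftrightarrow> ns = sorted_list_of_set (atoms S)"
proof -
  have sub: "atoms S \<subseteq> A" if "submonoid_generated A = S" for A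
  proof
    fix x assume "x \<in> atoms S"
    then have "x \<in> S" "x \<noteq> 0" "\<And>a b. a \<in> S \<Longrightarrow> b \<in> S \<Longrightarrow> x = a + b \<Longrightarrow> a = 0 \<or> b = 0"
      by (auto simp: atoms_def)
    then show "x \<in> A"
      using submonoid_generated_atom[of x A] unfolding that by blast
  qed
  have "set ns = atoms S" if min: "minimal_generators S ns"
  proof (rule ccontr)
    assume "set ns \<noteq> atoms S"
    then have "atoms S \<subset> set ns"
      using sub[of "set ns"] min by (auto simp: minimal_generators_def)
    then show False
      using min submonoid_generated_atoms[OF assms] by (auto simp: minimal_generators_def)
  qed
  moreover have "minimal_generators S ns" if "sorted_wrt (<) ns" "set ns = atoms S"
    using that sub submonoid_generated_atoms[OF assms] by (auto simp: minimal_generators_def)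
  ultimately have "minimal_generators S ns \<longleftrightarrow> sorted_wrt (<) ns \<and> set ns = atoms S"
    unfolding minimal_generators_def by blast
  also have "\<dots> \<longleftrightarrow> ns = sorted_list_of_set (atoms S)"
    using finite_atoms[OF assms] by (auto intro: strict_sorted_equal)
  finally show ?thesis .
qed

lemma minimal_generators_unique_exists:
  "numerical_semigroup S \<Longrightarrow> \<exists>!ns. minimal_generators S ns"
  by (simp add: minimal_generators_iff)

lemma frobenius_greatest:
  assumes "numerical_semigroup S"
  shows "frobenius S \<notin> int ` S" and "z \<notin> int ` S \<Longrightarrow> z \<le> frobenius S"
proof -
  have fin: "finite (UNIV - S)" using assms by (auto simp: numerical_semigroup_def)
  define X where "X = insert (-1) (int ` (UNIV - S))"
  have X: "finite X" "X \<noteq> {}" using fin by (auto simp: X_def)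
  have 1: "Max X \<notin> int ` S" using Max_in[OF X] unfolding X_def by auto
  have 2: "z \<le> Max X" if "z \<notin> int ` S" for z
  proof (cases "z \<ge> 0")
    case True
    then obtain n where "z = int n" by (auto elim: nonneg_int_cases)
    then have "z \<in> X" using that by (auto simp: X_def)
    then show ?thesis using X by simp
  next
    case False
    then have "z \<le> -1" by simp
    also have "-1 \<le> Max X" using X by (intro Max_ge) (auto simp: X_def)
    finally show ?thesis .
  qed
  have "frobenius S = Max X"
    unfolding frobenius_def by (rule Greatest_equality) (use 1 2 in auto)
  with 1 2 show "frobenius S \<notin> int ` S" "z \<notin> int ` S \<Longrightarrow> z \<le> frobenius S" by auto
qed

lemma keys_times_subset:
  assumes "p \<in> carrier (poly_ring e)" "q \<in> carrier (poly_ring e)"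
  shows "p * q \<in> carrier (poly_ring e)"
proof -
  { fix a assume "a \<in> Poly_Mapping.keys (p * q)"
    then obtain b c where "a = b + c" "b \<in> Poly_Mapping.keys p" "c \<in> Poly_Mapping.keys q"
      using keys_mult[of p q] by auto
    then have "Poly_Mapping.keys a \<subseteq> {..<e}"
      using assms Poly_Mapping.keys_add[of b c] by (force simp: poly_ring_def) }
  then show ?thesis by (auto simp: poly_ring_def)
qed

lemma cring_poly_ring: "cring (poly_ring e :: 'k::field mpoly ring)"
proof (rule cringI)
  have add: "p + q \<in> carrier (poly_ring e)"
    if "p \<in> carrier (poly_ring e)" "q \<in> carrier (poly_ring e)" for p q :: "'k mpoly"
    using that Poly_Mapping.keys_add[of p q] by (fastforce simp: poly_ring_def)
  show "abelian_group (poly_ring e :: 'k mpoly ring)"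
  proof (rule abelian_groupI)
    fix p :: "'k mpoly" assume "p \<in> carrier (poly_ring e)"
    then show "\<exists>q\<in>carrier (poly_ring e). q \<oplus>\<^bsub>poly_ring e\<^esub> p = \<zero>\<^bsub>poly_ring e\<^esub>"
      by (intro bexI[of _ "- p"]) (auto simp: poly_ring_def in_keys_iff)
  next
    fix p q :: "'k mpoly"
    assume "p \<in> carrier (poly_ring e)" "q \<in> carrier (poly_ring e)"
    from add[OF this] show "p \<oplus>\<^bsub>poly_ring e\<^esub> q \<in> carrier (poly_ring e)"
      by (simp add: poly_ring_def)
  qed (simp_all add: poly_ring_def ac_simps)
  show "comm_monoid (poly_ring e :: 'k mpoly ring)"
  proof (rule comm_monoidI)
    fix p q :: "'k mpoly"
    assume "p \<in> carrier (poly_ring e)" "q \<in> carrier (poly_ring e)"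
    from keys_times_subset[OF this] show "p \<otimes>\<^bsub>poly_ring e\<^esub> q \<in> carrier (poly_ring e)"
      by (simp add: poly_ring_def)
  qed (simp_all add: poly_ring_def ac_simps)
qed (auto simp: poly_ring_def distrib_right)

lemma cring_univariate_ring: "cring (univariate_ring :: 'k::field poly ring)"
proof (rule cringI)
  show "abelian_group (univariate_ring :: 'k poly ring)"
  proof (rule abelian_groupI)
    fix p :: "'k poly"
    show "\<exists>q\<in>carrier univariate_ring. q \<oplus>\<^bsub>univariate_ring\<^esub> p = \<zero>\<^bsub>univariate_ring\<^esub>"
      by (intro bexI[of _ "- p"]) (auto simp: univariate_ring_def)
  qed (simp_all add: univariate_ring_def ac_simps)
  show "comm_monoid (univariate_ring :: 'k poly ring)"
    by (rule comm_monoidI) (simp_all add: univariate_ring_def ac_simps)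
qed (auto simp: univariate_ring_def distrib_right)

lemma semigroup_map_add: "semigroup_map ns (p + q) = semigroup_map ns p + semigroup_map ns q"
  unfolding semigroup_map_def
  by (rule setsum_keys_plus_distrib) (auto simp: smult_add_left)

lemma semigroup_map_single:
  "semigroup_map ns (Poly_Mapping.single a c) =
     Polynomial.smult c (\<Prod>i\<in>Poly_Mapping.keys a. Polynomial.monom 1 (ns ! i) ^ Poly_Mapping.lookup a i)"
  by (simp add: semigroup_map_def)

lemma exponent_prod_add:
  fixes a b :: "nat \<Rightarrow>\<^sub>0 nat" and g :: "nat \<Rightarrow> 'b::comm_monoid_mult"
  shows "(\<Prod>i\<in>Poly_Mapping.keys (a + b). g i ^ Poly_Mapping.lookup (a + b) i) =
    (\<Prod>i\<in>Poly_Mapping.keys a. g i ^ Poly_Mapping.lookup a i) *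
    (\<Prod>i\<in>Poly_Mapping.keys b. g i ^ Poly_Mapping.lookup b i)"
proof -
  let ?K = "Poly_Mapping.keys a \<union> Poly_Mapping.keys b"
  have ext: "(\<Prod>i\<in>Poly_Mapping.keys d. g i ^ Poly_Mapping.lookup d i) =
      (\<Prod>i\<in>?K. g i ^ Poly_Mapping.lookup d i)" if "Poly_Mapping.keys d \<subseteq> ?K" for d
    using that by (intro prod.mono_neutral_left) (auto simp: in_keys_iff)
  have "Poly_Mapping.keys (a + b) \<subseteq> ?K" by (rule Poly_Mapping.keys_add)
  from ext[OF this] ext[of a] ext[of b] show ?thesis
    by (simp add: lookup_add power_add prod.distrib)
qed

lemma poly_mapping_induct_single:
  assumes "P 0" "\<And>a c. P (Poly_Mapping.single a c)" "\<And>p q. P p \<Longrightarrow> P q \<Longrightarrow> P (p + q)"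
  shows "P (p :: 'a \<Rightarrow>\<^sub>0 'b::comm_monoid_add)"
proof -
  have "p = (\<Sum>a\<in>Poly_Mapping.keys p. Poly_Mapping.single a (Poly_Mapping.lookup p a))"
    by (rule poly_mapping_eqI)
       (auto simp: lookup_sum lookup_single when_def in_keys_iff sum.delta)
  moreover have "P (\<Sum>a\<in>A. Poly_Mapping.single a (Poly_Mapping.lookup p a))" if "finite A" for A
    using that by induction (auto intro: assms)
  ultimately show ?thesis by (metis finite_keys)
qed

lemma semigroup_map_mult: "semigroup_map ns (p * q) = semigroup_map ns p * semigroup_map ns q"
proof (induction p rule: poly_mapping_induct_single)
  case (2 a c)
  show ?case
  proof (induction q rule: poly_mapping_induct_single)
    case (2 b d)
    then show ?case
      by (simp add: mult_single semigroup_map_single exponent_prod_add mult.commute)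
  qed (simp_all add: distrib_left semigroup_map_add, simp add: semigroup_map_def)
qed (simp_all add: distrib_right semigroup_map_add, simp add: semigroup_map_def)

lemma semigroup_map_var: "semigroup_map ns (var i) = Polynomial.monom 1 (ns ! i)"
  by (simp add: var_def semigroup_map_single)

lemma semigroup_map_const: "semigroup_map ns (Poly_Mapping.single 0 c) = [:c:]"
  by (simp add: semigroup_map_single)

lemma one_mpoly_const: "(1 :: 'k::field mpoly) = Poly_Mapping.single 0 1"
  by simp

lemma semigroup_map_ring_hom:
  assumes "minimal_generators S ns"
  shows "semigroup_map ns \<in> Ring.ring_hom (poly_ring (length ns)) (semigroup_ring S :: 'k::field poly ring)"
proof -
  let ?G = "generate_ring (univariate_ring :: 'k poly ring)
    (range (\<lambda>c. [:c:]) \<union> {Polynomial.monom 1 s | s. s \<in> S})"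
  have c: "[:c:] \<in> ?G" for c by (rule generate_ring.incl) auto
  have m: "p * q \<in> ?G" if "p \<in> ?G" "q \<in> ?G" for p q
    using generate_ring.eng_mult[OF that] by (simp add: univariate_ring_def)
  have a: "p + q \<in> ?G" if "p \<in> ?G" "q \<in> ?G" for p q
    using generate_ring.eng_add[OF that] by (simp add: univariate_ring_def)
  have z: "0 \<in> ?G" using c[of 0] by simp
  have o: "1 \<in> ?G" using c[of 1] by (simp add: one_pCons)
  have t: "Polynomial.monom 1 (ns ! i) \<in> ?G" if "i < length ns" for i
  proof -
    have "ns ! i \<in> submonoid_generated (set ns)"
      using that by (intro submonoid_generated.incl) simp
    then have "ns ! i \<in> S" using assms by (simp add: minimal_generators_def)
    then show ?thesis by (intro generate_ring.incl) blast
  qed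
  have pw: "p ^ n \<in> ?G" if "p \<in> ?G" for p n
    by (induction n) (auto intro: o m that)
  have pr: "(\<Prod>i\<in>A. f i) \<in> ?G" if "finite A" "\<And>i. i \<in> A \<Longrightarrow> f i \<in> ?G" for A :: "nat set" and f
    using that by (induction A) (auto intro: o m)
  have su: "(\<Sum>i\<in>A. f i) \<in> ?G" if "finite A" "\<And>i. i \<in> A \<Longrightarrow> f i \<in> ?G"
    for A :: "(nat \<Rightarrow>\<^sub>0 nat) set" and f
    using that by (induction A) (auto intro: z a)
  have sm: "Polynomial.smult d p \<in> ?G" if "p \<in> ?G" for d p
    using m[OF c[of d] that] by simp
  have "semigroup_map ns p \<in> ?G" if "p \<in> carrier (poly_ring (length ns))" for p
    unfolding semigroup_map_def
    by (intro su sm pr pw t) (use that in \<open>auto simp: poly_ring_def\<close>)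
  moreover have "semigroup_map ns (1 :: 'k mpoly) = 1"
    by (simp add: semigroup_map_const one_mpoly_const one_pCons del: single_one)
  ultimately show ?thesis
    by (intro ring_hom_memI)
       (auto simp: semigroup_ring_def univariate_ring_def poly_ring_def
          semigroup_map_add semigroup_map_mult)
qed

lemma semigroup_map_surj:
  assumes "minimal_generators S ns"
  shows "semigroup_map ns ` carrier (poly_ring (length ns)) =
    carrier (semigroup_ring S :: 'k::field poly ring)"
proof
  show "semigroup_map ns ` carrier (poly_ring (length ns)) \<subseteq> carrier (semigroup_ring S :: 'k poly ring)"
    using semigroup_map_ring_hom[OF assms] by (auto simp: Ring.ring_hom_def)
next
  let ?C = "carrier (poly_ring (length ns)) :: 'k mpoly set"
  let ?I = "semigroup_map ns ` ?C"
  interpret P: cring "poly_ring (length ns) :: 'k mpoly ring" by (rule cring_poly_ring)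
  interpret U: cring "univariate_ring :: 'k poly ring" by (rule cring_univariate_ring)
  have addC: "p + q \<in> ?C" if "p \<in> ?C" "q \<in> ?C" for p q
    using P.add.m_closed[OF that] by (simp add: poly_ring_def)
  have mulC: "p * q \<in> ?C" if "p \<in> ?C" "q \<in> ?C" for p q
    using P.m_closed[OF that] by (simp add: poly_ring_def)
  have I_mult: "p * q \<in> ?I" if "p \<in> ?I" "q \<in> ?I" for p q
    using that by (auto simp flip: semigroup_map_mult intro: mulC)
  have I_add: "p + q \<in> ?I" if "p \<in> ?I" "q \<in> ?I" for p q
    using that by (auto simp flip: semigroup_map_add intro: addC)
  have I_const: "[:c:] \<in> ?I" for c
    by (rule image_eqI[of _ _ "Poly_Mapping.single 0 c"])
       (auto simp: semigroup_map_const poly_ring_def)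
  have I_monom: "Polynomial.monom 1 s \<in> ?I" if "s \<in> S" for s
  proof -
    have "s \<in> submonoid_generated (set ns)"
      using that assms by (simp add: minimal_generators_def)
    then show ?thesis
    proof induction
      case zero
      then show ?case using I_const[of 1] by (simp add: one_pCons monom_0)
    next
      case (incl a)
      then obtain i where "i < length ns" "a = ns ! i" by (auto simp: in_set_conv_nth)
      then show ?case
        by (intro image_eqI[of _ _ "var i"])
             (simp add: semigroup_map_var, simp add: poly_ring_def var_def)
    next
      case (add x y)
      then show ?case using I_mult[OF add.IH] by (simp add: mult_monom)
    qed
  qed
  have U_neg: "\<ominus>\<^bsub>univariate_ring\<^esub> p = - p" for p :: "'k poly"
    by (rule U.minus_equality) (auto simp: univariate_ring_def)
  have "p \<in> ?I" if "p \<in> carrier (semigroup_ring S)" for p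
  proof -
    have "p \<in> generate_ring univariate_ring
        (range (\<lambda>c. [:c:]) \<union> {Polynomial.monom 1 s | s. s \<in> S})"
      using that by (simp add: semigroup_ring_def)
    then show ?thesis
  proof (induction rule: generate_ring.induct)
    case one
    then show ?case using I_const[of 1] by (simp add: univariate_ring_def one_pCons)
  next
    case (incl h)
    then show ?case using I_const I_monom by auto
  next
    case (a_inv h)
    then show ?case using I_mult[OF I_const[of "-1"], of h] by (simp add: U_neg)
  next
    case (eng_add h1 h2)
    then show ?case using I_add[of h1 h2] by (simp add: univariate_ring_def)
  next
    case (eng_mult h1 h2)
    then show ?case using I_mult[of h1 h2] by (simp add: univariate_ring_def)
  qed
  qed
  then show "carrier (semigroup_ring S :: 'k poly ring) \<subseteq> ?I" by blast
qed

end

theory Submission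
  imports Defs "HOL-Number_Theory.Cong"
begin

text \<open>
  Let \<open>m\<close> be the multiplicity of \<open>S\<close>, let \<open>F\<close> be the Frobenius number, and let the minimal generators
  \<open>n\<^sub>i\<close> be numbered increasingly from \<open>n\<^sub>0 = m\<close>.  The vectors \<open>v\<close> with \<open>\<Sum> v\<^sub>i n\<^sub>i = 0\<close> form a lattice \<open>L\<close>, and the defining
  ideal is generated by the binomials of all \<open>v \<in> L\<close>: two monomials of the same weight differ by a
  monomial multiple of such a binomial, so modulo these binomials every polynomial is a combination
  of one monomial per weight, and a polynomial in the kernel has all of these coefficients zero
  (\<open>defining_ideal_eq_genideal\<close>).  The rows of a row-factorization matrix all have weight \<open>F\<close>, so
  \<open>W(S) \<subseteq> L\<close>, and it suffices to find a matrix whose row differences generate \<open>L\<close>.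

  The Arf property enters only through the shape of the generators: an element that is a sum of two
  nonzero elements of \<open>S\<close> stays in \<open>S\<close> when \<open>m\<close> is subtracted.  By descent every nonzero \<open>s \<in> S\<close> is
  \<open>n\<^sub>j + t m\<close> for some generator \<open>n\<^sub>j\<close> and \<open>t \<ge> 0\<close>, and the generators, having distinct
  residues modulo \<open>m\<close>, represent each occurring residue once (\<open>arf_generators\<close>).

  For \<open>m = 1\<close> the lattice is zero, so let \<open>m \<ge> 2\<close>.  Write \<open>u\<^sub>i\<close> for the unit vectors.  Since \<open>F + n\<^sub>i\<close> lies in \<open>S\<close>, it equals \<open>n\<^bsub>\<sigma> i\<^esub> + t\<^sub>i m\<close> for some \<open>\<sigma> i\<close>,
  which makes \<open>u\<^bsub>\<sigma> i\<^esub> + t\<^sub>i u\<^sub>0 - u\<^sub>i\<close> an admissible row.  On residues \<open>\<sigma>\<close> is addition of \<open>F\<close>, so when \<open>F\<close>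
  is coprime to \<open>m\<close> its orbit of \<open>0\<close> contains all indices.  Following the orbit, each \<open>u\<^sub>i\<close> becomes a
  combination of \<open>u\<^sub>0\<close> and a single row \<open>z\<close> modulo the row differences, and closing the orbit
  yields a relation between \<open>m z\<close> and \<open>u\<^sub>0\<close>.  The weights of \<open>z\<close> and \<open>u\<^sub>0\<close> being coprime, this
  forces the row differences to exhaust \<open>L\<close> (\<open>row_lattice_full\<close>, \<open>rf_matrix_frobenius_coprime\<close>).

  If \<open>m\<close> divides the conductor \<open>F + 1\<close>, then \<open>F\<close> and \<open>m\<close> are coprime.  As \<open>m\<close> never divides \<open>F\<close>, they
  are coprime for \<open>m\<close> prime as well.  For \<open>2 \<le> m \<le> 5\<close> this leaves \<open>m = 4\<close> with \<open>F \<equiv> 2\<close> modulo \<open>4\<close>,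
  where \<open>\<sigma>\<close> has two orbits and the rows above do not suffice; replacing the row of the largest
  generator by one that joins the two orbits repairs this (\<open>rf_matrix_multiplicity_four\<close>).
\<close>

section \<open>Toric ideals\<close>

definition weight :: "nat list \<Rightarrow> (nat \<Rightarrow> int) \<Rightarrow> int" where
  "weight ns v = (\<Sum>k<length ns. v k * int (ns ! k))"

definition exponent :: "nat \<Rightarrow> (nat \<Rightarrow> nat) \<Rightarrow> (nat \<Rightarrow>\<^sub>0 nat)" where
  "exponent e a = (\<Sum>i<e. Poly_Mapping.single i (a i))"

lemma lookup_exponent: "Poly_Mapping.lookup (exponent e a) i = (if i < e then a i else 0)"
  by (simp add: exponent_def lookup_sum lookup_single when_def)

lemma var_power: "(var i :: 'k::field mpoly) ^ n = Poly_Mapping.single (Poly_Mapping.single i n) 1"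
  by (induction n) (simp_all add: var_def mult_single single_add[symmetric])

lemma monomial_eq_single:
  "(monomial a :: 'k::field mpoly) = Poly_Mapping.single (exponent (dim_vec a) (($) a)) 1"
proof -
  have "(\<Prod>i<n. (var i :: 'k mpoly) ^ (a $ i)) = Poly_Mapping.single (exponent n (($) a)) 1" for n
    by (induction n) (simp_all add: exponent_def var_power mult_single)
  then show ?thesis by (simp add: monomial_def)
qed

lemma semigroup_map_single_weight:
  assumes "Poly_Mapping.keys a \<subseteq> {..<length ns}"
  shows "semigroup_map ns (Poly_Mapping.single a c) =
    Polynomial.monom c (\<Sum>k<length ns. Poly_Mapping.lookup a k * ns ! k)"
proof -
  have pw: "(Polynomial.monom 1 n :: 'a poly) ^ l = Polynomial.monom 1 (l * n)" for n l
    by (simp add: monom_power mult.commute)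
  have pr: "(\<Prod>i\<in>A. Polynomial.monom (1::'a) (f i)) = Polynomial.monom 1 (sum f A)"
    if "finite A" for A :: "nat set" and f
    using that by induction (auto simp: mult_monom monom_0 one_pCons)
  have "(\<Prod>i\<in>Poly_Mapping.keys a. Polynomial.monom (1::'a) (ns ! i) ^ Poly_Mapping.lookup a i)
     = Polynomial.monom 1 (\<Sum>i\<in>Poly_Mapping.keys a. Poly_Mapping.lookup a i * ns ! i)"
    by (simp add: pw pr)
  also have "(\<Sum>i\<in>Poly_Mapping.keys a. Poly_Mapping.lookup a i * ns ! i)
     = (\<Sum>k<length ns. Poly_Mapping.lookup a k * ns ! k)"
    using assms by (intro sum.mono_neutral_left) (auto simp: in_keys_iff)
  finally show ?thesis by (simp add: semigroup_map_single smult_monom)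
qed

lemma binomial_eq_singles:
  assumes "dim_vec v = e"
  shows "(binomial v :: 'k::field mpoly) =
    Poly_Mapping.single (exponent e (\<lambda>i. nat (v $ i))) 1 -
    Poly_Mapping.single (exponent e (\<lambda>i. nat (- v $ i))) 1"
proof -
  have 1: "exponent e (($) (map_vec nat (pos_vec v))) = exponent e (\<lambda>i. nat (v $ i))"
    unfolding exponent_def using assms by (intro sum.cong) (auto simp: pos_vec_def)
  have 2: "exponent e (($) (map_vec nat (neg_vec v))) = exponent e (\<lambda>i. nat (- v $ i))"
    unfolding exponent_def using assms by (intro sum.cong) (auto simp: pos_vec_def neg_vec_def)
  have "dim_vec (pos_vec v) = e" "dim_vec (neg_vec v) = e"
    using assms by (simp_all add: pos_vec_def neg_vec_def)
  then show ?thesis by (simp add: binomial_def monomial_eq_single 1 2)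
qed

lemma keys_exponent: "Poly_Mapping.keys (exponent e a) \<subseteq> {..<e}"
  by (auto simp: in_keys_iff lookup_exponent split: if_splits)

lemma binomial_in_defining_ideal:
  assumes "dim_vec v = length ns" "weight ns (($) v) = 0"
  shows "(binomial v :: 'k::field mpoly) \<in> defining_ideal S ns"
proof -
  let ?e = "length ns"
  have "int (\<Sum>k<?e. nat (v $ k) * ns ! k) - int (\<Sum>k<?e. nat (- v $ k) * ns ! k)
    = (\<Sum>k<?e. v $ k * int (ns ! k))"
    unfolding of_nat_sum sum_subtractf[symmetric]
    by (intro sum.cong) (auto simp: algebra_simps nat_eq_iff max_def simp flip: left_diff_distrib)
  then have eq: "(\<Sum>k<?e. nat (v $ k) * ns ! k) = (\<Sum>k<?e. nat (- v $ k) * ns ! k)"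
    using assms(2) unfolding weight_def by linarith
  define a where "a = exponent ?e (\<lambda>i. nat (v $ i))"
  define b where "b = exponent ?e (\<lambda>i. nat (- v $ i))"
  have k: "Poly_Mapping.keys a \<subseteq> {..<?e}" "Poly_Mapping.keys b \<subseteq> {..<?e}"
    unfolding a_def b_def by (rule keys_exponent)+
  have bin: "(binomial v :: 'k mpoly) = Poly_Mapping.single a 1 + Poly_Mapping.single b (-1)"
    using binomial_eq_singles[OF assms(1)] by (simp add: a_def b_def single_uminus)
  have "semigroup_map ns (binomial v :: 'k mpoly) = 0"
    unfolding bin semigroup_map_add semigroup_map_single_weight[OF k(1)] semigroup_map_single_weight[OF k(2)]
    using eq by (simp add: a_def b_def lookup_exponent add_monom)
  moreover have "(binomial v :: 'k mpoly) \<in> carrier (poly_ring ?e)"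
  proof -
    have "Poly_Mapping.keys (binomial v :: 'k mpoly) \<subseteq> {a, b}"
      unfolding bin using Poly_Mapping.keys_add[of "Poly_Mapping.single a (1::'k)" "Poly_Mapping.single b (-1)"]
      by auto
    then show ?thesis using k by (auto simp: poly_ring_def)
  qed
  ultimately show ?thesis
    by (simp add: defining_ideal_def a_kernel_def' semigroup_ring_def univariate_ring_def)
qed

lemma ideal_defining_ideal:
  assumes "minimal_generators S ns"
  shows "ideal (defining_ideal S ns :: 'k::field mpoly set) (poly_ring (length ns))"
proof -
  interpret P: cring "poly_ring (length ns) :: 'k mpoly ring" by (rule cring_poly_ring)
  interpret U: cring "univariate_ring :: 'k poly ring" by (rule cring_univariate_ring)
  have "ring (semigroup_ring S :: 'k poly ring)"
    unfolding semigroup_ring_def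
    by (rule U.subring_is_ring, rule U.generate_ring_is_subring) (simp add: univariate_ring_def)
  then interpret H: ring_hom_ring "poly_ring (length ns)" "semigroup_ring S :: 'k poly ring" "semigroup_map ns"
    by (intro ring_hom_ringI2 P.ring_axioms semigroup_map_ring_hom assms)
  show ?thesis unfolding defining_ideal_def by (rule H.kernel_is_ideal)
qed

text \<open>After the common factor of the two monomials is taken out, what remains is the binomial of the
  difference of their exponents, a vector of weight zero.\<close>

lemma ideal_contains_equal_weight:
  fixes I :: "'k::field mpoly set"
  assumes I: "ideal I (poly_ring (length ns))"
    and bin: "\<And>v. dim_vec v = length ns \<Longrightarrow> weight ns (($) v) = 0 \<Longrightarrow> binomial v \<in> I"
    and a: "Poly_Mapping.keys a \<subseteq> {..<length ns}" and b: "Poly_Mapping.keys b \<subseteq> {..<length ns}"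
    and eq: "(\<Sum>k<length ns. Poly_Mapping.lookup a k * ns ! k) =
      (\<Sum>k<length ns. Poly_Mapping.lookup b k * ns ! k)"
  shows "Poly_Mapping.single a c - Poly_Mapping.single b c \<in> I"
proof -
  interpret I: ideal I "poly_ring (length ns)" by (rule I)
  let ?e = "length ns"
  define v where "v = vec ?e (\<lambda>k. int (Poly_Mapping.lookup a k) - int (Poly_Mapping.lookup b k))"
  have out: "Poly_Mapping.lookup a i = 0" "Poly_Mapping.lookup b i = 0" if "\<not> i < ?e" for i
    using that a b by (auto simp: in_keys_iff subset_iff)
  have p: "exponent ?e (\<lambda>i. nat (v $ i)) = a - b"
    by (rule poly_mapping_eqI) (simp add: lookup_exponent lookup_minus v_def out nat_minus_as_int)
  have n: "exponent ?e (\<lambda>i. nat (- v $ i)) = b - a"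
    by (rule poly_mapping_eqI) (simp add: lookup_exponent lookup_minus v_def out nat_minus_as_int)
  have "weight ns (($) v) = int (\<Sum>k<?e. Poly_Mapping.lookup a k * ns ! k)
      - int (\<Sum>k<?e. Poly_Mapping.lookup b k * ns ! k)"
    unfolding weight_def of_nat_sum sum_subtractf[symmetric]
    by (intro sum.cong) (auto simp: v_def algebra_simps)
  then have "binomial v \<in> I" using eq by (intro bin) (simp_all add: v_def)
  then have B: "Poly_Mapping.single (a - b) 1 - Poly_Mapping.single (b - a) 1 \<in> I"
    by (subst (asm) binomial_eq_singles[of v ?e]) (simp_all add: p n, simp add: v_def)
  \<comment> \<open>subtraction of exponents truncates, so \<open>d\<close> is their componentwise minimum\<close>
  define d where "d = a - (a - b)"
  have da: "d + (a - b) = a" and db: "d + (b - a) = b"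
    by (rule poly_mapping_eqI, simp add: d_def lookup_add lookup_minus)+
  have "Poly_Mapping.keys d \<subseteq> {..<?e}"
    using a by (auto simp: d_def in_keys_iff lookup_minus subset_iff)
  then have "Poly_Mapping.single d c \<in> carrier (poly_ring ?e)" by (auto simp: poly_ring_def)
  from I.I_l_closed[OF B this]
  have "Poly_Mapping.single d c * (Poly_Mapping.single (a - b) 1 - Poly_Mapping.single (b - a) 1) \<in> I"
    by (simp add: poly_ring_def)
  then show ?thesis by (simp add: right_diff_distrib mult_single da db)
qed

text \<open>Grouping a polynomial by weight and replacing, within each group, every monomial by a fixed
  one changes it by an element of \<open>I\<close>.  The coefficients of the result are those of the image in
  the semigroup ring, hence zero for a polynomial in the kernel.\<close>

lemma defining_ideal_subset:
  fixes I :: "'k::field mpoly set"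
  assumes I: "ideal I (poly_ring (length ns))"
    and bin: "\<And>v. dim_vec v = length ns \<Longrightarrow> weight ns (($) v) = 0 \<Longrightarrow> binomial v \<in> I"
  shows "defining_ideal S ns \<subseteq> I"
proof
  interpret I: ideal I "poly_ring (length ns)" by (rule I)
  let ?e = "length ns"
  fix p :: "'k mpoly" assume "p \<in> defining_ideal S ns"
  then have keys: "\<And>a. a \<in> Poly_Mapping.keys p \<Longrightarrow> Poly_Mapping.keys a \<subseteq> {..<?e}"
    and ker: "semigroup_map ns p = 0"
    by (auto simp: defining_ideal_def a_kernel_def' poly_ring_def semigroup_ring_def univariate_ring_def)
  define K where "K = Poly_Mapping.keys p"
  define deg where "deg a = (\<Sum>k<?e. Poly_Mapping.lookup a k * ns ! k)" for a
  define rep where "rep d = (SOME a. a \<in> K \<and> deg a = d)" for d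
  have rep: "rep (deg a) \<in> K" "deg (rep (deg a)) = deg a" if "a \<in> K" for a
    using someI[of "\<lambda>b. b \<in> K \<and> deg b = deg a" a] that unfolding rep_def by auto
  have fin: "finite K" by (simp add: K_def)
  have expand: "p = (\<Sum>a\<in>K. Poly_Mapping.single a (Poly_Mapping.lookup p a))"
    unfolding K_def by (rule poly_mapping_eqI)
       (auto simp: lookup_sum lookup_single when_def in_keys_iff sum.delta)
  have map_sum: "semigroup_map ns (sum f A) = (\<Sum>a\<in>A. semigroup_map ns (f a))"
    if "finite A" for f :: "(nat \<Rightarrow>\<^sub>0 nat) \<Rightarrow> 'k mpoly" and A
    using that by induction (simp_all add: semigroup_map_add, simp add: semigroup_map_def)
  have "semigroup_map ns p = (\<Sum>a\<in>K. Polynomial.monom (Poly_Mapping.lookup p a) (deg a))"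
    by (subst expand, subst map_sum[OF fin], rule sum.cong)
       (auto simp: semigroup_map_single_weight[OF keys] K_def deg_def)
  then have "(\<Sum>a\<in>K. Polynomial.coeff (Polynomial.monom (Poly_Mapping.lookup p a) (deg a)) d) = 0" for d
    unfolding ker coeff_sum[symmetric] by (metis Polynomial.coeff_0)
  then have coeff0: "(\<Sum>a\<in>{a\<in>K. deg a = d}. Poly_Mapping.lookup p a) = 0" for d
    using fin by (simp add: sum.If_cases Int_def)
  have single_sum: "(\<Sum>a\<in>A. Poly_Mapping.single x (f a)) = Poly_Mapping.single x (sum f A)"
    for f :: "(nat \<Rightarrow>\<^sub>0 nat) \<Rightarrow> 'k" and A and x :: "nat \<Rightarrow>\<^sub>0 nat"
    by (rule poly_mapping_eqI) (auto simp: lookup_sum lookup_single when_def)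
  have "(\<Sum>a\<in>K. Poly_Mapping.single (rep (deg a)) (Poly_Mapping.lookup p a)) =
     (\<Sum>d\<in>deg ` K. \<Sum>a\<in>{a\<in>K. deg a = d}. Poly_Mapping.single (rep (deg a)) (Poly_Mapping.lookup p a))"
    by (rule sum.image_gen[OF fin])
  also have "\<dots> = (\<Sum>d\<in>deg ` K. Poly_Mapping.single (rep d)
      (\<Sum>a\<in>{a\<in>K. deg a = d}. Poly_Mapping.lookup p a))"
    by (intro sum.cong refl) (simp flip: single_sum)
  also have "\<dots> = 0" by (simp add: coeff0)
  finally have diff: "p = (\<Sum>a\<in>K. Poly_Mapping.single a (Poly_Mapping.lookup p a)
      - Poly_Mapping.single (rep (deg a)) (Poly_Mapping.lookup p a))"
    unfolding sum_subtractf by (subst expand) simp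
  \<comment> \<open>additive closure of \<open>I\<close>, for sums of the underlying type instead of the ring record\<close>
  have sum_in: "sum f A \<in> I" if "finite A" "\<And>a. a \<in> A \<Longrightarrow> f a \<in> I"
    for f :: "(nat \<Rightarrow>\<^sub>0 nat) \<Rightarrow> 'k mpoly" and A
    using that
  proof induction
    case empty
    then show ?case using additive_subgroup.zero_closed[OF I.is_additive_subgroup] by (simp add: poly_ring_def)
  next
    case (insert x A)
    then have "f x \<oplus>\<^bsub>poly_ring ?e\<^esub> sum f A \<in> I"
      by (intro additive_subgroup.a_closed[OF I.is_additive_subgroup]) auto
    then show ?case using insert by (simp add: poly_ring_def)
  qed
  have "Poly_Mapping.single a (Poly_Mapping.lookup p a) -
      Poly_Mapping.single (rep (deg a)) (Poly_Mapping.lookup p a) \<in> I" if "a \<in> K" for a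
    by (rule ideal_contains_equal_weight[OF I bin])
       (use that rep[OF that] keys in \<open>auto simp: K_def deg_def\<close>)
  with fin have "(\<Sum>a\<in>K. Poly_Mapping.single a (Poly_Mapping.lookup p a) -
      Poly_Mapping.single (rep (deg a)) (Poly_Mapping.lookup p a)) \<in> I"
    by (rule sum_in)
  then show "p \<in> I" by (subst diff)
qed

lemma defining_ideal_eq_genideal:
  assumes "minimal_generators S ns"
    and W: "W = {v. dim_vec v = length ns \<and> weight ns (($) v) = 0}"
  shows "(defining_ideal S ns :: 'k::field mpoly set) =
    genideal (poly_ring (length ns)) {binomial v | v. v \<in> W}"
proof
  show "defining_ideal S ns \<subseteq> genideal (poly_ring (length ns)) {binomial v :: 'k mpoly | v. v \<in> W}"
    unfolding genideal_def
    by (rule Inter_greatest, rule defining_ideal_subset) (use W in auto)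
  show "genideal (poly_ring (length ns)) {binomial v :: 'k mpoly | v. v \<in> W} \<subseteq> defining_ideal S ns"
    unfolding genideal_def
    using ideal_defining_ideal[OF assms(1)] binomial_in_defining_ideal W by (intro Inter_lower) auto
qed

section \<open>Lattices of row differences\<close>

definition unit :: "nat \<Rightarrow> nat \<Rightarrow> int" where
  "unit i k = (if k = i then 1 else 0)"

text \<open>The integer span of the differences of the rows, encoded as the combinations of the rows
  with coefficient sum zero.  Rows are functions on all indices, so that the lattice is closed under
  pointwise operations; only coordinates below \<open>e\<close> matter for matrices.\<close>

definition row_lattice :: "nat \<Rightarrow> (nat \<Rightarrow> nat \<Rightarrow> int) \<Rightarrow> (nat \<Rightarrow> int) set" where
  "row_lattice e A = {v. \<exists>c. (\<Sum>i<e. c i) = 0 \<and> (\<forall>k. v k = (\<Sum>i<e. c i * A i k))}"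

lemma row_lattice_combination:
  assumes "x \<in> row_lattice e A" "y \<in> row_lattice e A" "\<And>k. v k = a * x k + b * y k"
  shows "v \<in> row_lattice e A"
proof -
  obtain c d where c: "(\<Sum>i<e. c i) = 0" "\<And>k. x k = (\<Sum>i<e. c i * A i k)"
    and d: "(\<Sum>i<e. d i) = 0" "\<And>k. y k = (\<Sum>i<e. d i * A i k)"
    using assms(1,2) by (auto simp: row_lattice_def)
  have "(\<Sum>i<e. a * c i + b * d i) = 0"
    using c(1) d(1) by (simp add: sum.distrib flip: sum_distrib_left)
  moreover have "v k = (\<Sum>i<e. (a * c i + b * d i) * A i k)" for k
    by (simp add: assms(3) c(2) d(2) sum_distrib_left sum.distrib distrib_right mult.assoc)
  ultimately show ?thesis unfolding row_lattice_def by (auto intro!: exI[of _ "\<lambda>i. a * c i + b * d i"])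
qed

lemma row_lattice_zero: "(\<lambda>k. 0) \<in> row_lattice e A"
  unfolding row_lattice_def by (auto intro!: exI[of _ "\<lambda>_. 0"])

lemma row_lattice_difference:
  assumes "i < e" "j < e"
  shows "(\<lambda>k. A i k - A j k) \<in> row_lattice e A"
proof -
  have delta: "(\<Sum>l<e. (unit i l - unit j l) * f l) = f i - f j" for f :: "nat \<Rightarrow> int"
  proof -
    have "(\<Sum>l<e. (unit i l - unit j l) * f l) =
        (\<Sum>l<e. (if l = i then f l else 0)) - (\<Sum>l<e. (if l = j then f l else 0))"
      unfolding sum_subtractf[symmetric] by (intro sum.cong) (auto simp: unit_def)
    then show ?thesis using assms by simp
  qed
  have "(\<Sum>l<e. unit i l - unit j l) = 0" using delta[of "\<lambda>_. 1"] by simp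
  then show ?thesis unfolding row_lattice_def using delta
    by (auto intro!: exI[of _ "\<lambda>l. unit i l - unit j l"])
qed

lemma row_lattice_sum:
  assumes "finite B" "\<And>i. i \<in> B \<Longrightarrow> x i \<in> row_lattice e A"
  shows "(\<lambda>k. \<Sum>i\<in>B. c i * x i k) \<in> row_lattice e A"
  using assms
proof induction
  case empty
  then show ?case by (simp add: row_lattice_zero)
next
  case (insert i B)
  show ?case
    by (rule row_lattice_combination[of "x i" e A "\<lambda>k. \<Sum>i\<in>B. c i * x i k" _ "c i" 1])
       (use insert in auto)
qed

lemma weight_sum: "weight ns (\<lambda>k. \<Sum>p\<in>B. c p * x p k) = (\<Sum>p\<in>B. c p * weight ns (x p))"
  unfolding weight_def sum_distrib_right sum_distrib_left mult.assoc by (rule sum.swap)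

lemma weight_row_lattice:
  assumes "v \<in> row_lattice (length ns) A" "\<And>i. i < length ns \<Longrightarrow> weight ns (A i) = f"
  shows "weight ns v = 0"
proof -
  obtain c where c: "(\<Sum>i<length ns. c i) = 0" "\<And>k. v k = (\<Sum>i<length ns. c i * A i k)"
    using assms(1) by (auto simp: row_lattice_def)
  have "weight ns v = (\<Sum>i<length ns. c i * weight ns (A i))"
    unfolding c(2)[abs_def] by (rule weight_sum)
  also have "\<dots> = (\<Sum>i<length ns. c i * f)" using assms(2) by (intro sum.cong) auto
  also have "\<dots> = 0" using c(1) by (simp flip: sum_distrib_right)
  finally show ?thesis .
qed

lemma weight_unit: "i < length ns \<Longrightarrow> weight ns (unit i) = int (ns ! i)"
proof -
  assume "i < length ns"
  have "weight ns (unit i) = (\<Sum>k<length ns. if k = i then int (ns ! k) else 0)"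
    unfolding weight_def by (intro sum.cong) (auto simp: unit_def)
  then show ?thesis using \<open>i < length ns\<close> by simp
qed

lemma weight_linear:
  "weight ns (\<lambda>k. x k + y k) = weight ns x + weight ns y"
  "weight ns (\<lambda>k. x k - y k) = weight ns x - weight ns y"
  "weight ns (\<lambda>k. a * x k) = a * weight ns x"
  by (simp_all add: weight_def distrib_right left_diff_distrib sum.distrib sum_subtractf
      sum_distrib_left mult.assoc)

text \<open>Modulo the row differences every vector reduces to \<open>a u\<^sub>0 + b w\<close>.  If its weight is zero, then
  coprimality of the weights of \<open>w\<close> and \<open>u\<^sub>0\<close> makes \<open>(a, b)\<close> an integer multiple of the pair given
  by \<open>closing\<close>, whose \<open>\<gamma>\<close> is forced by the weight.  So the vector reduces to zero.\<close>

lemma row_lattice_full: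
  assumes rows: "\<And>i. i < length ns \<Longrightarrow> weight ns (A i) = f"
    and ns: "ns \<noteq> []" "ns ! 0 \<noteq> 0"
    and gen: "\<And>i. i < length ns \<Longrightarrow>
      \<exists>\<alpha> \<beta>. (\<lambda>k. unit i k - \<alpha> * unit 0 k - \<beta> * w k) \<in> row_lattice (length ns) A"
    and closing: "(\<lambda>k. int (ns ! 0) * w k - \<gamma> * unit 0 k) \<in> row_lattice (length ns) A"
    and cop: "coprime (weight ns w) (int (ns ! 0))"
    and v: "\<And>k. k \<ge> length ns \<Longrightarrow> v k = 0" "weight ns v = 0"
  shows "v \<in> row_lattice (length ns) A"
proof -
  let ?e = "length ns" and ?L = "row_lattice (length ns) A"
  let ?m = "int (ns ! 0)" and ?d = "weight ns w"
  have "\<forall>i. \<exists>\<alpha> \<beta>. i < ?e \<longrightarrow> (\<lambda>k. unit i k - \<alpha> * unit 0 k - \<beta> * w k) \<in> ?L"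
    using gen by blast
  from choice[OF this] obtain \<alpha> where
    "\<forall>i. \<exists>\<beta>. i < ?e \<longrightarrow> (\<lambda>k. unit i k - \<alpha> i * unit 0 k - \<beta> * w k) \<in> ?L"
    by blast
  from choice[OF this] obtain \<beta> where
    ab: "\<And>i. i < ?e \<Longrightarrow> (\<lambda>k. unit i k - \<alpha> i * unit 0 k - \<beta> i * w k) \<in> ?L"
    by blast
  have w0: "weight ns (unit 0) = ?m" using ns by (simp add: weight_unit)
  define a where "a = (\<Sum>i<?e. v i * \<alpha> i)"
  define b where "b = (\<Sum>i<?e. v i * \<beta> i)"
  define x where "x = (\<lambda>k. \<Sum>i<?e. v i * (unit i k - \<alpha> i * unit 0 k - \<beta> i * w k))"
  have x: "x \<in> ?L" unfolding x_def by (rule row_lattice_sum) (auto intro: ab)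
  have "(\<Sum>i<?e. v i * unit i k) = v k" for k
  proof -
    have "(\<Sum>i<?e. v i * unit i k) = (\<Sum>i<?e. if i = k then v i else 0)"
      by (intro sum.cong) (auto simp: unit_def)
    then show ?thesis using v(1)[of k] by (cases "k < ?e") auto
  qed
  then have xk: "x k = v k - a * unit 0 k - b * w k" for k
    by (simp add: x_def a_def b_def sum_subtractf right_diff_distrib sum_distrib_right mult.assoc)
  have "weight ns x = weight ns v - a * ?m - b * ?d"
    unfolding xk[abs_def] by (simp add: weight_linear w0)
  then have ab0: "a * ?m + b * ?d = 0" using weight_row_lattice[OF x rows] v(2) by simp
  then have "b * ?d = ?m * (- a)" by (simp add: algebra_simps)
  then have "?m dvd b * ?d" by simp
  then have "?m dvd b" using cop by (simp add: coprime_dvd_mult_left_iff coprime_commute)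
  then obtain s where s: "b = ?m * s" by blast
  have "weight ns (\<lambda>k. ?m * w k - \<gamma> * unit 0 k) = 0"
    using weight_row_lattice[OF closing rows] by simp
  then have "?m * ?d = \<gamma> * ?m" by (simp add: weight_linear w0)
  then have g: "\<gamma> = ?d" using ns by simp
  have "?m * (a + s * ?d) = 0" using ab0 unfolding s by (simp add: algebra_simps)
  then have "a + s * ?d = 0" using ns(2) by simp
  then have a: "a = - (s * ?d)" by linarith
  have "v k = 1 * x k + s * (?m * w k - \<gamma> * unit 0 k)" for k
    unfolding xk g s a by (simp add: algebra_simps)
  then show ?thesis by (rule row_lattice_combination[OF x closing])
qed

text \<open>Bridge from the functions above to the module of a matrix: a combination of the rows with
  coefficient sum zero is a combination of their differences from the first row.\<close>

lemma row_difference_module_eq: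
  assumes rows: "\<And>i. i < length ns \<Longrightarrow> weight ns (A i) = f"
    and full: "\<And>v. (\<And>k. k \<ge> length ns \<Longrightarrow> v k = 0) \<Longrightarrow> weight ns v = 0 \<Longrightarrow>
      v \<in> row_lattice (length ns) A"
  shows "row_difference_module (mat (length ns) (length ns) (\<lambda>(i, j). A i j)) =
    {v. dim_vec v = length ns \<and> weight ns (($) v) = 0}"
proof -
  let ?e = "length ns" and ?M = "mat (length ns) (length ns) (\<lambda>(i, j). A i j)"
  let ?P = "{(i, j). i < j \<and> j < ?e}"
  have fin: "finite ?P" by (rule finite_subset[of _ "{..<?e} \<times> {..<?e}"]) auto
  have row: "(row ?M i - row ?M j) $ k = A i k - A j k" if "i < ?e" "j < ?e" "k < ?e" for i j k
    using that by simp
  have sub: "weight ns (($) (vec ?e (\<lambda>k. \<Sum>(i, j)\<in>?P. c i j * ((row ?M i - row ?M j) $ k)))) = 0" for c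
  proof -
    have "weight ns (($) (vec ?e (\<lambda>k. \<Sum>(i, j)\<in>?P. c i j * ((row ?M i - row ?M j) $ k))))
      = weight ns (\<lambda>k. \<Sum>p\<in>?P. case_prod c p * (A (fst p) k - A (snd p) k))"
      unfolding weight_def by (intro sum.cong refl) (auto simp: row intro!: arg_cong2[of _ _ _ _ "(*)"] sum.cong)
    also have "\<dots> = (\<Sum>p\<in>?P. case_prod c p * (weight ns (A (fst p)) - weight ns (A (snd p))))"
      by (simp only: weight_sum[where x = "\<lambda>p k. A (fst p) k - A (snd p) k"] weight_linear)
    also have "\<dots> = 0" using rows by (intro sum.neutral) auto
    finally show ?thesis .
  qed
  have sup: "v \<in> row_difference_module ?M" if v: "dim_vec v = ?e" "weight ns (($) v) = 0" for v
  proof (cases "?e = 0")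
    case True
    then show ?thesis using v unfolding row_difference_module_def by (auto intro!: exI[of _ "\<lambda>_ _. 0"])
  next
    case False
    define u where "u k = (if k < ?e then v $ k else 0)" for k
    have "weight ns u = 0" using v(2) by (simp add: weight_def u_def)
    then have "u \<in> row_lattice ?e A" by (intro full) (auto simp: u_def)
    then obtain c where c: "(\<Sum>i<?e. c i) = 0" "\<And>k. u k = (\<Sum>i<?e. c i * A i k)"
      by (auto simp: row_lattice_def)
    define d where "d i j = (if i = 0 then - c j else 0)" for i j :: nat
    have "v = vec ?e (\<lambda>k. \<Sum>(i, j)\<in>?P. d i j * ((row ?M i - row ?M j) $ k))"
    proof (rule eq_vecI)
      fix k assume "k < dim_vec (vec ?e (\<lambda>k. \<Sum>(i, j)\<in>?P. d i j * ((row ?M i - row ?M j) $ k)))"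
      then have k: "k < ?e" by simp
      have "(\<Sum>(i, j)\<in>?P. d i j * ((row ?M i - row ?M j) $ k)) =
        (\<Sum>(i, j)\<in>Pair 0 ` {1..<?e}. d i j * ((row ?M i - row ?M j) $ k))"
        using fin by (intro sum.mono_neutral_right) (auto simp: d_def)
      also have "\<dots> = (\<Sum>j\<in>{1..<?e}. d 0 j * ((row ?M 0 - row ?M j) $ k))"
        by (subst sum.reindex) (auto simp: inj_on_def)
      also have "\<dots> = (\<Sum>j\<in>{1..<?e}. c j * (A j k - A 0 k))"
      proof (rule sum.cong[OF refl])
        fix j assume "j \<in> {1..<?e}"
        then have "(row ?M 0 - row ?M j) $ k = A 0 k - A j k" using k by (intro row) auto
        then show "d 0 j * ((row ?M 0 - row ?M j) $ k) = c j * (A j k - A 0 k)"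
          by (simp only: d_def) (simp add: algebra_simps)
      qed
      also have "\<dots> = (\<Sum>j<?e. c j * (A j k - A 0 k))"
        by (intro sum.mono_neutral_left) (auto simp: not_le)
      also have "\<dots> = u k - (\<Sum>j<?e. c j) * A 0 k"
        by (simp add: c(2) right_diff_distrib sum_subtractf sum_distrib_right)
      finally show "v $ k = vec ?e (\<lambda>k. \<Sum>(i, j)\<in>?P. d i j * ((row ?M i - row ?M j) $ k)) $ k"
        using k c(1) by (simp add: u_def)
    qed (simp add: v)
    then show ?thesis unfolding row_difference_module_def by auto
  qed
  show ?thesis
  proof (intro equalityI subsetI)
    fix v assume "v \<in> row_difference_module ?M"
    then obtain c where "v = vec ?e (\<lambda>k. \<Sum>(i, j)\<in>?P. c i j * ((row ?M i - row ?M j) $ k))"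
      unfolding row_difference_module_def by auto
    then show "v \<in> {v. dim_vec v = ?e \<and> weight ns (($) v) = 0}" using sub[of c] by simp
  qed (use sup in auto)
qed

lemma rf_matrix_with_full_lattice:
  assumes "minimal_generators S ns"
    and rows: "\<And>i. i < length ns \<Longrightarrow> weight ns (A i) = f"
    and diag: "\<And>i. i < length ns \<Longrightarrow> A i i = -1"
    and off: "\<And>i j. i < length ns \<Longrightarrow> j < length ns \<Longrightarrow> i \<noteq> j \<Longrightarrow> A i j \<ge> 0"
    and full: "\<And>v. (\<And>k. k \<ge> length ns \<Longrightarrow> v k = 0) \<Longrightarrow> weight ns v = 0 \<Longrightarrow>
      v \<in> row_lattice (length ns) A"
  shows "\<exists>M. rf_matrix ns f M \<and>
    (defining_ideal S ns :: 'k::field mpoly set) =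
      genideal (poly_ring (length ns)) {binomial v | v. v \<in> row_difference_module M}"
proof (intro exI conjI)
  let ?M = "mat (length ns) (length ns) (\<lambda>(i, j). A i j)"
  show "rf_matrix ns f ?M"
    using rows diag off by (auto simp: rf_matrix_def weight_def)
  show "(defining_ideal S ns :: 'k mpoly set) =
      genideal (poly_ring (length ns)) {binomial v | v. v \<in> row_difference_module ?M}"
    by (rule defining_ideal_eq_genideal[OF assms(1)]) (rule row_difference_module_eq[OF rows full])
qed

section \<open>Generators of Arf semigroups\<close>

lemma multiplicity_least:
  assumes "numerical_semigroup S"
  shows "multiplicity S \<in> S" "multiplicity S \<noteq> 0" "\<And>s. s \<in> S \<Longrightarrow> s \<noteq> 0 \<Longrightarrow> multiplicity S \<le> s"
proof -
  have "infinite S"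
  proof
    assume "finite S"
    moreover have "finite (UNIV - S)" using assms by (simp add: numerical_semigroup_def)
    ultimately have "finite (S \<union> (UNIV - S))" by (rule finite_UnI)
    then show False by simp
  qed
  then have "\<not> S \<subseteq> {0}" using finite_subset by blast
  then have "\<exists>s. s \<in> S \<and> s \<noteq> 0" by auto
  from LeastI_ex[OF this] show "multiplicity S \<in> S" "multiplicity S \<noteq> 0"
    by (simp_all add: multiplicity_def)
  show "multiplicity S \<le> s" if "s \<in> S" "s \<noteq> 0" for s
    unfolding multiplicity_def by (rule Least_le) (use that in simp)
qed

lemma numerical_semigroup_multiple:
  "numerical_semigroup S \<Longrightarrow> s \<in> S \<Longrightarrow> t * s \<in> S"
  by (induction t) (auto simp: numerical_semigroup_def)

text \<open>By descent: if \<open>s\<close> is a sum of two nonzero elements, then the smaller summand is at least the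
  multiplicity, and the Arf property with the multiplicity as the smallest of the three elements
  shows that \<open>s - multiplicity S\<close> lies in \<open>S\<close>.\<close>

lemma arf_atom_plus_multiple:
  assumes "numerical_semigroup S" "arf S" "s \<in> S" "s \<noteq> 0"
  shows "\<exists>a\<in>atoms S. \<exists>t. s = a + t * multiplicity S"
  using assms(3,4)
proof (induction s rule: less_induct)
  case (less s)
  note m = multiplicity_least[OF assms(1)]
  show ?case
  proof (cases "s \<in> atoms S")
    case True
    then show ?thesis by (intro bexI[of _ s] exI[of _ 0]) auto
  next
    case False
    then obtain a b where ab: "a \<in> S" "b \<in> S" "s = a + b" "a \<noteq> 0" "b \<noteq> 0"
      using less.prems by (auto simp: atoms_def)
    have shift: "c + d - multiplicity S \<in> S" if "c \<in> S" "c \<noteq> 0" "d \<in> S" "c \<le> d" for c d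
      using assms(2) m(1) m(3)[OF that(1,2)] that unfolding arf_def by blast
    have "s - multiplicity S \<in> S"
      using shift[of a b] shift[of b a] ab by (cases "a \<le> b") (simp_all add: add.commute)
    moreover have "multiplicity S < s" using m(3)[OF ab(1,4)] ab(3,5) by linarith
    moreover from this have "s - multiplicity S < s" "s - multiplicity S \<noteq> 0"
      using m(2) by simp_all
    ultimately obtain c t where "c \<in> atoms S" "s - multiplicity S = c + t * multiplicity S"
      using less.IH[of "s - multiplicity S"] by blast
    moreover from this have "s = c + Suc t * multiplicity S"
      using \<open>multiplicity S < s\<close> unfolding mult_Suc by linarith
    ultimately show ?thesis by blast
  qed
qed

text \<open>The larger of two congruent atoms would be the smaller one plus a multiple of the
  multiplicity.\<close>

lemma atoms_mod_multiplicity_inj: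
  assumes S: "numerical_semigroup S" and "x \<in> atoms S" "y \<in> atoms S"
    and "x mod multiplicity S = y mod multiplicity S"
  shows "x = y"
proof -
  let ?m = "multiplicity S"
  note m = multiplicity_least[OF S]
  have wlog: False if xy: "x \<in> atoms S" "y \<in> atoms S" "x < y" "x mod ?m = y mod ?m" for x y
  proof -
    obtain t where t: "y = x + ?m * t"
      by (rule mod_eq_nat2E[OF xy(4) less_imp_le[OF xy(3)]])
    have "t * ?m \<in> S" by (rule numerical_semigroup_multiple[OF S m(1)])
    moreover have y: "y = x + t * ?m" by (simp only: t mult.commute)
    moreover have "x \<in> S" "x \<noteq> 0" using xy(1) by (simp_all add: atoms_def)
    moreover have "\<And>a b. a \<in> S \<Longrightarrow> b \<in> S \<Longrightarrow> y = a + b \<Longrightarrow> a = 0 \<or> b = 0"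
      using xy(2) unfolding atoms_def by blast
    ultimately have "t * ?m = 0" by metis
    then show False using y xy(3) by linarith
  qed
  show ?thesis
    using wlog[OF assms(2,3) _ assms(4)] wlog[OF assms(3,2) _ assms(4)[symmetric]]
    by (meson linorder_neqE_nat)
qed

lemma arf_generators:
  assumes S: "numerical_semigroup S" and "arf S" and mg: "minimal_generators S ns"
  shows "ns \<noteq> []" and "ns ! 0 = multiplicity S"
    and "\<And>i. i < length ns \<Longrightarrow> ns ! i \<in> S \<and> ns ! i \<noteq> 0"
    and "\<And>i j. i < length ns \<Longrightarrow> j < length ns \<Longrightarrow>
      ns ! i mod multiplicity S = ns ! j mod multiplicity S \<Longrightarrow> i = j"
    and "\<And>s. s \<in> S \<Longrightarrow> s \<noteq> 0 \<Longrightarrow> \<exists>j<length ns. \<exists>t. s = ns ! j + t * multiplicity S"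
proof -
  let ?m = "multiplicity S"
  note m = multiplicity_least[OF S]
  have ns: "ns = sorted_list_of_set (atoms S)" using mg minimal_generators_iff[OF S] by simp
  have set: "set ns = atoms S" using finite_atoms[OF S] by (simp add: ns)
  have "?m \<in> atoms S" unfolding atoms_def
  proof (intro CollectI conjI ballI impI m)
    fix a b assume "a \<in> S" "b \<in> S" "?m = a + b"
    then show "a = 0 \<or> b = 0" using m(3)[of a] m(3)[of b] by linarith
  qed
  then have "?m \<in> set ns" by (simp only: set)
  then obtain i where i: "i < length ns" "ns ! i = ?m" unfolding in_set_conv_nth by blast
  show el: "ns ! i \<in> S \<and> ns ! i \<noteq> 0" if "i < length ns" for i
    using nth_mem[OF that] set by (auto simp: atoms_def)
  show "ns \<noteq> []" using i(1) by auto
  then have "?m \<le> ns ! 0" using el[of 0] m(3)[of "ns ! 0"] by simp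
  moreover have "sorted ns" by (simp add: ns)
  then have "ns ! 0 \<le> ns ! i" using i(1) by (intro sorted_nth_mono) simp_all
  ultimately show "ns ! 0 = ?m" using i(2) by simp
  show "i = j" if "i < length ns" "j < length ns" "ns ! i mod ?m = ns ! j mod ?m" for i j
  proof -
    have "ns ! i = ns ! j"
      using nth_mem[OF that(1)] nth_mem[OF that(2)] unfolding set
      by (rule atoms_mod_multiplicity_inj[OF S _ _ that(3)])
    moreover have "distinct ns" by (simp add: ns)
    ultimately show ?thesis using that(1,2) by (simp add: nth_eq_iff_index_eq)
  qed
  show "\<exists>j<length ns. \<exists>t. s = ns ! j + t * ?m" if s: "s \<in> S" "s \<noteq> 0" for s
  proof -
    obtain a t where "a \<in> set ns" "s = a + t * ?m"
      using arf_atom_plus_multiple[OF S assms(2) s] set by blast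
    then show ?thesis unfolding in_set_conv_nth by blast
  qed
qed

section \<open>Matrices whose row differences generate the lattice\<close>

text \<open>All rows have the form \<open>u\<^bsub>\<sigma> i\<^esub> + t\<^sub>i u\<^sub>0 - u\<^sub>i\<close>, where \<open>\<sigma>\<close> shifts residues by the Frobenius number.
  Coprimality makes this shift a single cycle through all generators.\<close>

lemma rf_matrix_frobenius_coprime:
  fixes N :: nat
  assumes S: "numerical_semigroup S" and arf: "arf S" and mg: "minimal_generators S ns"
    and N: "frobenius S = int N" and cop: "coprime N (multiplicity S)"
  shows "\<exists>M. rf_matrix ns (frobenius S) M \<and>
    (defining_ideal S ns :: 'k::field mpoly set) =
      genideal (poly_ring (length ns)) {binomial v | v. v \<in> row_difference_module M}"
proof -
  define m where "m = multiplicity S"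
  let ?e = "length ns" and ?L = "row_lattice (length ns)"
  note g = arf_generators[OF S arf mg, folded m_def]
  have e0: "0 < ?e" using g(1) by simp
  have mult: "t * m \<in> S" for t
    unfolding m_def by (intro numerical_semigroup_multiple[OF S] multiplicity_least[OF S])
  have closed: "x + y \<in> S" if "x \<in> S" "y \<in> S" for x y
    using S that by (simp add: numerical_semigroup_def)
  have NS: "N \<notin> S" using frobenius_greatest(1)[OF S] N by auto
  have big: "s \<in> S" if "s > N" for s
  proof -
    have "int s \<in> int ` S" using frobenius_greatest(2)[OF S, of "int s"] that N by linarith
    then show ?thesis by auto
  qed
  have "\<forall>i. \<exists>p. i < ?e \<longrightarrow> fst p < ?e \<and> N + ns ! i = ns ! fst p + snd p * m"
  proof
    fix i
    show "\<exists>p. i < ?e \<longrightarrow> fst p < ?e \<and> N + ns ! i = ns ! fst p + snd p * m"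
      using g(5)[OF big[of "N + ns ! i"]] g(3)[of i] by (cases "i < ?e") auto
  qed
  from choice[OF this] obtain P where
    P: "\<And>i. i < ?e \<Longrightarrow> fst (P i) < ?e \<and> N + ns ! i = ns ! fst (P i) + snd (P i) * m"
    by blast
  define \<sigma> where "\<sigma> i = fst (P i)" for i
  define t where "t i = snd (P i)" for i
  have \<sigma>: "\<sigma> i < ?e" "N + ns ! i = ns ! \<sigma> i + t i * m" if "i < ?e" for i
    using P[OF that] by (auto simp: \<sigma>_def t_def)
  have fix_free: "\<sigma> i \<noteq> i" if "i < ?e" for i
  proof
    assume "\<sigma> i = i"
    then have "N = t i * m" using \<sigma>(2)[OF that] by simp
    then show False using mult[of "t i"] NS by simp
  qed
  \<comment> \<open>the row of the multiplicity must have \<open>-1\<close> in its own column, so no multiple of \<open>u\<^sub>0\<close> may occur\<close>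
  have t0: "t 0 = 0"
  proof (rule ccontr)
    assume "t 0 \<noteq> 0"
    then obtain q where "t 0 = Suc q" by (cases "t 0") auto
    then have "N = ns ! \<sigma> 0 + q * m" using \<sigma>(2)[OF e0] g(2) by simp
    moreover have "ns ! \<sigma> 0 + q * m \<in> S" using g(3)[OF \<sigma>(1)[OF e0]] mult by (intro closed) simp_all
    ultimately show False using NS by simp
  qed
  define A where "A i k = unit (\<sigma> i) k + int (t i) * unit 0 k - unit i k" for i k
  have rows: "weight ns (A i) = int N" if "i < ?e" for i
  proof -
    have "weight ns (A i) = int (ns ! \<sigma> i) + int (t i) * int m - int (ns ! i)"
      unfolding A_def[abs_def] using that \<sigma>(1)[OF that] e0 by (simp add: weight_linear weight_unit g(2))
    also have "\<dots> = int (ns ! \<sigma> i + t i * m) - int (ns ! i)" by simp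
    also have "\<dots> = int N" by (simp flip: \<sigma>(2)[OF that])
    finally show ?thesis .
  qed
  have full: "v \<in> ?L A" if v: "\<And>k. k \<ge> ?e \<Longrightarrow> v k = 0" "weight ns v = 0" for v
  proof -
    define \<tau> where "\<tau> k = (\<sigma> ^^ k) 0" for k
    have \<tau>: "\<tau> 0 = 0" "\<tau> (Suc k) = \<sigma> (\<tau> k)" for k by (simp_all add: \<tau>_def)
    have \<tau>e: "\<tau> k < ?e" for k by (induction k) (simp_all add: \<tau> \<sigma> g(1))
    have \<tau>mod: "ns ! \<tau> k mod m = k * N mod m" for k
    proof (induction k)
      case 0
      then show ?case by (simp add: \<tau> g(2))
    next
      case (Suc k)
      have "ns ! \<tau> (Suc k) mod m = (ns ! \<sigma> (\<tau> k) + t (\<tau> k) * m) mod m" by (simp add: \<tau>)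
      also have "\<dots> = (N + ns ! \<tau> k) mod m" by (simp only: \<sigma>(2)[OF \<tau>e])
      also have "\<dots> = (N + k * N) mod m" by (metis Suc mod_add_right_eq)
      finally show ?case by simp
    qed
    \<comment> \<open>each step along the orbit adds one copy of row \<open>0\<close> and a multiple of \<open>u\<^sub>0\<close>\<close>
    have \<tau>L: "\<exists>\<alpha>. (\<lambda>x. unit (\<tau> k) x - \<alpha> * unit 0 x - int k * A 0 x) \<in> ?L A" for k
    proof (induction k)
      case 0
      show ?case by (rule exI[of _ 1]) (simp add: \<tau> row_lattice_zero)
    next
      case (Suc k)
      then obtain \<alpha> where \<alpha>: "(\<lambda>x. unit (\<tau> k) x - \<alpha> * unit 0 x - int k * A 0 x) \<in> ?L A" by blast
      have "(\<lambda>x. unit (\<tau> (Suc k)) x - (\<alpha> - int (t (\<tau> k))) * unit 0 x - int (Suc k) * A 0 x) \<in> ?L A"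
        by (rule row_lattice_combination[OF \<alpha> row_lattice_difference[OF \<tau>e[of k] e0], of _ 1 1])
           (simp add: \<tau> A_def[of "\<tau> k"] algebra_simps)
      then show ?case by blast
    qed
    have reach: "\<exists>k. i = \<tau> k" if "i < ?e" for i
    proof -
      obtain x where x: "[N * x = Suc 0] (mod m)"
        using cong_solve_coprime_nat[of N m] cop by (auto simp: m_def)
      have "(x * ns ! i) * N mod m = ns ! i mod m"
        using cong_scalar_left[OF x, of "ns ! i"] by (simp add: cong_def mult_ac)
      then show ?thesis using g(4)[OF that \<tau>e[of "x * ns ! i"]] \<tau>mod by auto
    qed
    have "\<tau> m = 0" using g(4)[OF \<tau>e[of m] e0] \<tau>mod[of m] by (simp add: g(2))
    with \<tau>L[of m] obtain \<alpha> where \<alpha>: "(\<lambda>x. unit 0 x - \<alpha> * unit 0 x - int m * A 0 x) \<in> ?L A" by auto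
    show ?thesis
    proof (rule row_lattice_full[where w = "A 0" and \<gamma> = "1 - \<alpha>" and f = "int N"])
      show "(\<lambda>k. int (ns ! 0) * A 0 k - (1 - \<alpha>) * unit 0 k) \<in> ?L A"
        by (rule row_lattice_combination[OF \<alpha> \<alpha>, of _ "-1" 0]) (simp add: g(2) algebra_simps)
      show "coprime (weight ns (A 0)) (int (ns ! 0))"
        using cop by (simp add: rows[OF e0] g(2) m_def)
      show "\<exists>\<alpha> \<beta>. (\<lambda>k. unit i k - \<alpha> * unit 0 k - \<beta> * A 0 k) \<in> ?L A" if "i < ?e" for i
        using reach[OF that] \<tau>L by blast
      show "ns ! 0 \<noteq> 0" using g(3)[OF e0] by simp
    qed (simp_all add: rows g(1) v)
  qed
  show ?thesis unfolding N
  proof (rule rf_matrix_with_full_lattice[OF mg rows _ _ full])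
    show "A i i = -1" if "i < ?e" for i
      using fix_free[OF that] t0 by (auto simp: A_def unit_def)
    show "A i j \<ge> 0" if "i \<noteq> j" for i j
      using that by (auto simp: A_def unit_def)
  qed
qed

text \<open>Let \<open>p\<close>, \<open>a\<close>, \<open>b\<close> be the indices of the generators of residue 2, 1, 3.  Shifting residues by 2
  has the orbits \<open>{0, p}\<close> and \<open>{a, b}\<close>, and the rows \<open>u\<^bsub>\<sigma> i\<^esub> + t\<^sub>i u\<^sub>0 - u\<^sub>i\<close> would leave \<open>u\<^sub>a\<close> unrelated to
  \<open>u\<^sub>0\<close>.  The row of \<open>p\<close> therefore factors \<open>F + n\<^sub>p = 2 F + 4\<close> through \<open>n\<^sub>a\<close> and \<open>n\<^sub>b\<close> instead.
  This is possible because \<open>F + 3\<close> and \<open>F + 1\<close> lie in \<open>S\<close> with residues 1 and 3, so that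
  \<open>n\<^sub>a \<le> F + 3\<close> and \<open>n\<^sub>b \<le> F + 1\<close>.\<close>

lemma rf_matrix_multiplicity_four:
  fixes N :: nat
  assumes S: "numerical_semigroup S" and arf: "arf S" and mg: "minimal_generators S ns"
    and N: "frobenius S = int N" and N2: "N mod 4 = 2" and m4: "multiplicity S = 4"
  shows "\<exists>M. rf_matrix ns (frobenius S) M \<and>
    (defining_ideal S ns :: 'k::field mpoly set) =
      genideal (poly_ring (length ns)) {binomial v | v. v \<in> row_difference_module M}"
proof -
  let ?e = "length ns" and ?L = "row_lattice (length ns)"
  note g = arf_generators[OF S arf mg, unfolded m4]
  have e0: "0 < ?e" using g(1) by simp
  have mult: "t * 4 \<in> S" for t
    using numerical_semigroup_multiple[OF S multiplicity_least(1)[OF S], of t] by (simp add: m4)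
  have closed: "x + y \<in> S" if "x \<in> S" "y \<in> S" for x y
    using S that by (simp add: numerical_semigroup_def)
  have NS: "N \<notin> S" using frobenius_greatest(1)[OF S] N by auto
  have big: "s \<in> S" if "s > N" for s
  proof -
    have "int s \<in> int ` S" using frobenius_greatest(2)[OF S, of "int s"] that N by linarith
    then show ?thesis by auto
  qed
  have factor: "\<exists>j t. j < ?e \<and> s = ns ! j + t * 4" if "s > N" for s
    using g(5)[OF big[OF that]] that by auto
  obtain p tp where p: "p < ?e" "N + 4 = ns ! p + tp * 4" using factor[of "N + 4"] by auto
  obtain a ta where a: "a < ?e" "N + 3 = ns ! a + ta * 4" using factor[of "N + 3"] by auto
  obtain b tb where b: "b < ?e" "N + 1 = ns ! b + tb * 4" using factor[of "N + 1"] by auto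
  have tp: "tp = 0"
  proof (rule ccontr)
    assume "tp \<noteq> 0"
    then obtain q where "tp = Suc q" by (cases tp) auto
    then have "N = ns ! p + q * 4" using p(2) by simp
    moreover have "ns ! p + q * 4 \<in> S" using g(3)[OF p(1)] mult by (intro closed) simp_all
    ultimately show False using NS by simp
  qed
  have res: "ns ! 0 mod 4 = 0" "ns ! a mod 4 = 1" "ns ! p mod 4 = 2" "ns ! b mod 4 = 3"
    using N2 p(2) a(2) b(2) g(2) by presburger+
  have ne: "i \<noteq> j" if "ns ! i mod 4 \<noteq> ns ! j mod 4" for i j using that by blast
  have dist: "0 \<noteq> a" "0 \<noteq> p" "0 \<noteq> b" "a \<noteq> p" "a \<noteq> b" "p \<noteq> b"
    using res ne[of 0 a] ne[of 0 p] ne[of 0 b] ne[of a p] ne[of a b] ne[of p b] by simp_all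
  have cases4: "i = 0 \<or> i = a \<or> i = p \<or> i = b" if "i < ?e" for i
  proof -
    have "ns ! i mod 4 = 0 \<or> ns ! i mod 4 = 1 \<or> ns ! i mod 4 = 2 \<or> ns ! i mod 4 = 3" by presburger
    then show ?thesis
      using g(4)[OF that e0] g(4)[OF that a(1)] g(4)[OF that p(1)] g(4)[OF that b(1)]
      unfolding res by (elim disjE) simp_all
  qed
  obtain j1 t1 where j1: "j1 < ?e" "N + ns ! a = ns ! j1 + t1 * 4"
    using factor[of "N + ns ! a"] g(3)[OF a(1)] by auto
  have "(ns ! j1 + t1 * 4) mod 4 = (N mod 4 + ns ! a mod 4) mod 4"
    unfolding j1(2)[symmetric] by (simp only: mod_add_eq)
  then have "ns ! j1 mod 4 = ns ! b mod 4" by (simp add: N2 res)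
  then have t1: "N + ns ! a = ns ! b + t1 * 4" using g(4)[OF j1(1) b(1)] j1(2) by simp
  obtain j3 t3 where j3: "j3 < ?e" "N + ns ! b = ns ! j3 + t3 * 4"
    using factor[of "N + ns ! b"] g(3)[OF b(1)] by auto
  have "(ns ! j3 + t3 * 4) mod 4 = (N mod 4 + ns ! b mod 4) mod 4"
    unfolding j3(2)[symmetric] by (simp only: mod_add_eq)
  then have "ns ! j3 mod 4 = ns ! a mod 4" by (simp add: N2 res)
  then have t3: "N + ns ! b = ns ! a + t3 * 4" using g(4)[OF j3(1) a(1)] j3(2) by simp
  define T where "T = ta + tb"
  have T: "N + ns ! p = ns ! a + ns ! b + T * 4" using p(2) tp a(2) b(2) by (simp add: T_def)
  define A where "A i = (if i = 0 then (\<lambda>k. unit p k - unit 0 k)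
     else if i = a then (\<lambda>k. unit b k + int t1 * unit 0 k - unit a k)
     else if i = b then (\<lambda>k. unit a k + int t3 * unit 0 k - unit b k)
     else (\<lambda>k. unit a k + unit b k + int T * unit 0 k - unit p k))" for i
  have A: "A 0 = (\<lambda>k. unit p k - unit 0 k)"
    "A a = (\<lambda>k. unit b k + int t1 * unit 0 k - unit a k)"
    "A b = (\<lambda>k. unit a k + int t3 * unit 0 k - unit b k)"
    "A p = (\<lambda>k. unit a k + unit b k + int T * unit 0 k - unit p k)"
    using dist by (auto simp: A_def)
  have "weight ns (A 0) = int N" "weight ns (A a) = int N" "weight ns (A b) = int N"
    "weight ns (A p) = int N"
    using p(2) tp t1 t3 T unfolding A weight_linear weight_unit[OF e0] weight_unit[OF a(1)]
      weight_unit[OF b(1)] weight_unit[OF p(1)] g(2) by linarith+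
  then have rows: "weight ns (A i) = int N" if "i < ?e" for i
    using cases4[OF that] by blast
  have full: "v \<in> ?L A" if v: "\<And>k. k \<ge> ?e \<Longrightarrow> v k = 0" "weight ns v = 0" for v
  proof -
    have R1: "(\<lambda>k. A a k - A 0 k) \<in> ?L A" and R2: "(\<lambda>k. A b k - A 0 k) \<in> ?L A"
      and R3: "(\<lambda>k. A p k - A 0 k) \<in> ?L A"
      using a(1) b(1) p(1) e0 by (auto intro: row_lattice_difference)
    \<comment> \<open>Up to multiples of \<open>u\<^sub>0\<close>, \<open>D\<close> is \<open>-2 u\<^sub>p\<close>, \<open>Y\<close> is \<open>u\<^sub>a + u\<^sub>b\<close> and \<open>X\<close> is \<open>2 u\<^sub>a + u\<^sub>p\<close>.  So \<open>u\<^sub>p\<close>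
      and \<open>u\<^sub>b\<close> reduce to \<open>u\<^sub>a\<close>, and \<open>2 X + D\<close> gives the closing relation for \<open>4 u\<^sub>a\<close>.\<close>
    define D where "D k = (A a k - A 0 k) + (A b k - A 0 k)" for k
    define Y where "Y k = (A p k - A 0 k) - D k" for k
    define X where "X k = Y k - (A a k - A 0 k)" for k
    have D: "D \<in> ?L A" by (rule row_lattice_combination[OF R1 R2, of _ 1 1]) (simp add: D_def)
    have Y: "Y \<in> ?L A" by (rule row_lattice_combination[OF R3 D, of _ 1 "-1"]) (simp add: Y_def)
    have X: "X \<in> ?L A" by (rule row_lattice_combination[OF Y R1, of _ 1 "-1"]) (simp add: X_def)
    show ?thesis
    proof (rule row_lattice_full[where w = "unit a" and f = "int N"])
      show "(\<lambda>k. int (ns ! 0) * unit a k - (3 * int t1 + int t3 + 2 - 2 * int T) * unit 0 k) \<in> ?L A"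
        by (rule row_lattice_combination[OF X D, of _ 2 1])
           (simp add: X_def Y_def D_def A g(2) algebra_simps)
      have "odd (ns ! a)" using res(2) by presburger
      then have "coprime (ns ! a) (2 ^ 2)" by (subst coprime_power_right_iff) simp
      then show "coprime (weight ns (unit a)) (int (ns ! 0))"
        using g(2) coprime_int_iff[of "ns ! a" 4] by (simp add: weight_unit[OF a(1)])
      show "\<exists>\<alpha> \<beta>. (\<lambda>k. unit i k - \<alpha> * unit 0 k - \<beta> * unit a k) \<in> ?L A" if "i < ?e" for i
        using cases4[OF that]
      proof (elim disjE)
        assume "i = 0"
        then show ?thesis by (intro exI[of _ 1] exI[of _ 0]) (simp add: row_lattice_zero)
      next
        assume "i = a"
        then show ?thesis by (intro exI[of _ 0] exI[of _ 1]) (simp add: row_lattice_zero)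
      next
        assume i: "i = p"
        have "(\<lambda>k. unit i k - (2 * int t1 + int t3 + 2 - int T) * unit 0 k - (-2) * unit a k) \<in> ?L A"
          by (rule row_lattice_combination[OF X X, of _ 1 0])
             (simp add: i X_def Y_def D_def A algebra_simps)
        then show ?thesis by blast
      next
        assume i: "i = b"
        have "(\<lambda>k. unit i k - (int t1 + int t3 + 1 - int T) * unit 0 k - (-1) * unit a k) \<in> ?L A"
          by (rule row_lattice_combination[OF Y Y, of _ 1 0])
             (simp add: i Y_def D_def A algebra_simps)
        then show ?thesis by blast
      qed
      show "ns ! 0 \<noteq> 0" using g(2) by simp
    qed (simp_all add: rows g(1) v)
  qed
  show ?thesis unfolding N
  proof (rule rf_matrix_with_full_lattice[OF mg rows _ _ full])
    show "A i i = -1" if "i < ?e" for i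
      using cases4[OF that] dist by (elim disjE) (simp_all add: A unit_def)
    show "A i j \<ge> 0" if "i < ?e" "j < ?e" "i \<noteq> j" for i j
      using cases4[OF that(1)] that(3) by (elim disjE) (simp_all add: A unit_def)
  qed
qed

text \<open>Here \<open>S\<close> is the set of all natural numbers, its Frobenius number is \<open>-1\<close>, and the only matrix
  is \<open>(-1)\<close>.\<close>

lemma rf_matrix_multiplicity_one:
  assumes S: "numerical_semigroup S" and arf: "arf S" and mg: "minimal_generators S ns"
    and m1: "multiplicity S = 1"
  shows "\<exists>M. rf_matrix ns (frobenius S) M \<and>
    (defining_ideal S ns :: 'k::field mpoly set) =
      genideal (poly_ring (length ns)) {binomial v | v. v \<in> row_difference_module M}"
proof -
  note g = arf_generators[OF S arf mg, unfolded m1]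
  have i0: "i = 0" if "i < length ns" for i using g(4)[OF that, of 0] g(1) by simp
  then have e1: "length ns = 1" using g(1) i0[of 1] by (cases "length ns") force+
  have "s \<in> S" for s
    using numerical_semigroup_multiple[OF S multiplicity_least(1)[OF S], of s] by (simp add: m1)
  then have "z \<in> int ` S" if "z \<ge> 0" for z :: int
    using that by (intro image_eqI[of _ _ "nat z"]) auto
  then have "frobenius S < 0" using frobenius_greatest(1)[OF S] by (meson not_le)
  moreover have "-1 \<le> frobenius S" by (rule frobenius_greatest(2)[OF S]) auto
  ultimately have f: "frobenius S = -1" by simp
  show ?thesis unfolding f
  proof (rule rf_matrix_with_full_lattice[OF mg, of "\<lambda>i k. - unit i k"])
    fix v :: "nat \<Rightarrow> int" assume v: "\<And>k. k \<ge> length ns \<Longrightarrow> v k = 0" "weight ns v = 0"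
    have "v k = 0" for k using v(1)[of k] v(2) e1 g(2) by (cases k) (auto simp: weight_def)
    then have "v = (\<lambda>k. 0)" by auto
    then show "v \<in> row_lattice (length ns) (\<lambda>i k. - unit i k)" by (simp add: row_lattice_zero)
  qed (use e1 g(2) in \<open>auto simp: weight_def unit_def\<close>)
qed

theorem theorem5p5:
  fixes S :: "nat set" and ns :: "nat list"
  assumes "numerical_semigroup S" and "arf S"
    and "multiplicity S \<le> 5 \<or> int (multiplicity S) dvd conductor S"
    and "minimal_generators S ns"
  shows "\<exists>A. rf_matrix ns (frobenius S) A \<and>
    (defining_ideal S ns :: 'k::{alg_closed_field, field_char_0} mpoly set) =
      genideal (poly_ring (length ns)) {binomial v | v. v \<in> row_difference_module A}"
proof (cases "multiplicity S = 1")
  case True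
  then show ?thesis using rf_matrix_multiplicity_one assms by blast
next
  case False
  let ?m = "multiplicity S"
  note S = assms(1)
  note m = multiplicity_least[OF S]
  have m2: "?m \<ge> 2" using False m(2) by linarith
  then have "1 \<notin> S" using m(3)[of 1] by auto
  then have "1 \<le> frobenius S" by (intro frobenius_greatest(2)[OF S]) auto
  then obtain N where N: "frobenius S = int N" by (metis zero_le_imp_eq_int zero_le_one order_trans)
  have "N \<notin> S" using frobenius_greatest(1)[OF S] N by auto
  then have ndvd: "\<not> ?m dvd N"
    using numerical_semigroup_multiple[OF S m(1)] by (auto simp: dvd_def mult.commute)
  have "coprime N ?m \<or> (?m = 4 \<and> N mod 4 = 2)"
    using assms(3)
  proof
    assume "int ?m dvd conductor S"
    then have "int ?m dvd int (Suc N)" by (simp add: conductor_def N add.commute)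
    then have "?m dvd Suc N" by (simp only: of_nat_dvd_iff)
    moreover have "coprime N (Suc N)" by simp
    ultimately show ?thesis by (meson coprime_divisors dvd_refl)
  next
    assume "?m \<le> 5"
    then consider "?m = 2" | "?m = 3" | "?m = 4" | "?m = 5" using m2 by linarith
    then show ?thesis
    proof cases
      case 3
      then have "N mod 4 = 2 \<or> odd N" using ndvd by presburger
      moreover have "coprime N 4" if "odd N"
        using that coprime_power_right_iff[of N 2 2] by simp
      ultimately show ?thesis using 3 by auto
    qed (use ndvd prime_imp_coprime[of ?m N] in \<open>auto simp: coprime_commute\<close>)
  qed
  then show ?thesis
    using rf_matrix_frobenius_coprime[OF S assms(2,4) N] rf_matrix_multiplicity_four[OF S assms(2,4) N]
    by blast
qed

end
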